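(* Let $d,n\ge1$ be integers. Let $\{X_i\}_{i=1,2,3,\dots}$ be a stochastic process, let $\mathcal{F}_i=\sigma(X_1,\dots,X_i)$ be the filtration of corresponding $\sigma$-fields up to time $i$ (with $\mathcal{F}_0$ the trivial $\sigma$-field), and let $\boldsymbol{\phi}_i=[\phi_{i1}\ \phi_{i2}\ \cdots\ \phi_{id}]^\top\in\mathbb{R}^d$ be given by deterministic measurable functions $\boldsymbol{\phi}_i=\boldsymbol{\phi}_i(X_1,\dots,X_i)$ such that $\mathbb{E}[\boldsymbol{\phi}_i\mid\mathcal{F}_{i-1}]=\mathbf{0}$ for all $i$. Consider the following conditions, in which the $\sigma_i$ and $\sigma_{ij}$ are deterministic constants: (I) $\mathbb{E}[\exp(\phi_{ij}^2/\sigma_{ij}^2)\mid\mathcal{F}_{i-1}]\le\exp(1)$, where $\sum_{j=1}^d\sigma_{ij}^2\le\sigma_i^2$, for all $i=1,\dots,n$ and $j=1,\dots,d$, with $\sigma_{ij},\sigma_i>0$; (II) $\mathbb{E}[\exp(\|\boldsymbol{\phi}_i\|^2/\sigma_i^2)\mid\mathcal{F}_{i-1}]\le\exp(1)$ for all $i=1,\dots,n$, with $\sigma_i>0$; (III) $\mathbb{E}[\exp((\mathbf{e}^\top\boldsymbol{\phi}_i)^2/\sigma_i^2)\mid\mathcal{F}_{i-1}]\le\exp(1)$ for every unit vector $\mathbf{e}\in\mathbb{R}^d$ and all $i=1,\dots,n$, with $\sigma_i>0$. Then for every $\lambda\ge0$, $$\mathbb{P}\Big[\Big\|\sum_{i=1}^n\boldsymbol{\phi}_i\Big\|\ge\lambda\sqrt{\sum_{i=1}^n\sigma_i^2}\,\Big]\le\begin{cases}2\exp(-\lambda^2/4),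 & \text{if (I) holds};\\ (d+1)\exp(-\lambda^2/3), & \text{if (II) holds};\\ 5^d\exp(-\lambda^2/12), & \text{if (III) holds},\end{cases}$$ and, given any one of the conditions (I), (II), (III), $$\mathbb{P}\Big[\mathbf{e}^\top\sum_{i=1}^n\boldsymbol{\phi}_i\ge\lambda\sqrt{\sum_{i=1}^n\sigma_i^2}\,\Big]\le\exp(-\lambda^2/3)$$ for every unit vector $\mathbf{e}\in\mathbb{R}^d$ and every $\lambda\ge0$.
   Context: $\|\cdot\|$ denotes the Euclidean norm on $\mathbb{R}^d$, and unit vectors are with respect to it. (In)equalities between conditional expectations hold almost surely. *)

theory Defs
  imports "HOL-Probability.Probability"
begin

text \<open>The process is indexed by \<open>1, 2, \<dots>\<close>; the value \<open>X 0\<close> is never used. For \<open>i = 0\<close> the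
  family of generators is empty, so this is the trivial \<open>\<sigma>\<close>-field.\<close>

definition nat_filtration ::
    "'a measure \<Rightarrow> 'b measure \<Rightarrow> (nat \<Rightarrow> 'a \<Rightarrow> 'b) \<Rightarrow> nat \<Rightarrow> 'a measure" where
  "nat_filtration M S X i =
     sigma (space M) (\<Union>k\<in>{1..i}. {X k -` A \<inter> space M | A. A \<in> sets S})"

text \<open>In the three conditions the conditional expectation is the one for \<open>ennreal\<close>-valued functions,
  so that an upper bound on it carries no integrability assumption and is not satisfied vacuously
  by a non-integrable exponential.\<close>

definition cond_I ::
    "'a measure \<Rightarrow> (nat \<Rightarrow> 'a measure) \<Rightarrow> nat \<Rightarrow> (nat \<Rightarrow> 'a \<Rightarrow> real^'d::finite)
      \<Rightarrow> (nat \<Rightarrow> real) \<Rightarrow> (nat \<Rightarrow> 'd \<Rightarrow> real) \<Rightarrow> bool" where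
  "cond_I M F n \<phi> \<sigma> \<tau> \<longleftrightarrow>
     (\<forall>i\<in>{1..n}. \<sigma> i > 0 \<and> (\<forall>j. \<tau> i j > 0) \<and> (\<Sum>j\<in>UNIV. (\<tau> i j)\<^sup>2) \<le> (\<sigma> i)\<^sup>2 \<and>
        (\<forall>j. AE \<omega> in M. nn_cond_exp M (F (i - 1))
                (\<lambda>\<omega>. ennreal (exp ((\<phi> i \<omega> $ j)\<^sup>2 / (\<tau> i j)\<^sup>2))) \<omega> \<le> ennreal (exp 1)))"

definition cond_II ::
    "'a measure \<Rightarrow> (nat \<Rightarrow> 'a measure) \<Rightarrow> nat \<Rightarrow> (nat \<Rightarrow> 'a \<Rightarrow> real^'d::finite)
      \<Rightarrow> (nat \<Rightarrow> real) \<Rightarrow> bool" where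
  "cond_II M F n \<phi> \<sigma> \<longleftrightarrow>
     (\<forall>i\<in>{1..n}. \<sigma> i > 0 \<and>
        (AE \<omega> in M. nn_cond_exp M (F (i - 1))
           (\<lambda>\<omega>. ennreal (exp ((norm (\<phi> i \<omega>))\<^sup>2 / (\<sigma> i)\<^sup>2))) \<omega> \<le> ennreal (exp 1)))"

definition cond_III ::
    "'a measure \<Rightarrow> (nat \<Rightarrow> 'a measure) \<Rightarrow> nat \<Rightarrow> (nat \<Rightarrow> 'a \<Rightarrow> real^'d::finite)
      \<Rightarrow> (nat \<Rightarrow> real) \<Rightarrow> bool" where
  "cond_III M F n \<phi> \<sigma> \<longleftrightarrow>
     (\<forall>i\<in>{1..n}. \<sigma> i > 0 \<and>
        (\<forall>e. norm e = 1 \<longrightarrow>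
           (AE \<omega> in M. nn_cond_exp M (F (i - 1))
              (\<lambda>\<omega>. ennreal (exp ((e \<bullet> \<phi> i \<omega>)\<^sup>2 / (\<sigma> i)\<^sup>2))) \<omega> \<le> ennreal (exp 1))))"

end

theory Submission
  imports Defs
begin

text \<open>
  Write \<open>S\<^sub>n = \<phi>\<^sub>1 + \<dots> + \<phi>\<^sub>n\<close> and \<open>V = \<sigma>\<^sub>1\<^sup>2 + \<dots> + \<sigma>\<^sub>n\<^sup>2\<close>. All the bounds come from Markov's
  inequality applied to an exponential functional of \<open>S\<^sub>n\<close> whose expectation is at most
  \<open>exp (3 \<theta>\<^sup>2 V / 4)\<close>; the choice \<open>\<theta> = 2 r / (3 \<surd>V)\<close> then produces the exponent \<open>- r\<^sup>2 / 3\<close>. For a linear form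
  \<open>e \<bullet> S\<^sub>n\<close> the functional is \<open>exp (\<theta> (e \<bullet> S\<^sub>n))\<close>, for the norm it is \<open>cosh (\<theta> \<parallel>S\<^sub>n\<parallel>)\<close>.

  Both functionals grow by the same mechanism. When an increment \<open>v\<close> is added, the new value is at
  most the old value times \<open>exp (\<theta> z) - \<theta> z\<close>, where \<open>z\<close> is the size of \<open>v\<close>, plus a term that is linear in
  \<open>v\<close> with a coefficient known before \<open>v\<close> is drawn, and hence has expectation zero. For the
  exponential this is a one-variable fact (\<open>exp_le_exp_abs\<close>). For \<open>cosh \<parallel>\<cdot>\<parallel>\<close> it is
  \<open>cosh_norm_add_le\<close>, an inequality of the kind used by Pinelis, which holds in every inner product
  space with constants that do not depend on the dimension. It rests on the convexity of
  \<open>cosh \<circ> sqrt\<close>, which reduces the claim to increments parallel to the current position.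
  The factor \<open>exp (\<theta> z) - \<theta> z\<close> is controlled by \<open>exp z - z \<le> exp (9 z\<^sup>2 / 16)\<close>
  (\<open>exp_minus_self_le_exp_sq\<close>) as long as \<open>\<theta> \<sigma>\<^sub>i \<le> 4 / 3\<close>, and by a cruder estimate for larger \<open>\<theta>\<close>; the
  latter determines the constant \<open>3 / 4\<close>, and with it the \<open>1 / 3\<close> in the exponent
  (\<open>exp_minus_self_le_affine_exp_sq\<close>). The two parts meet in \<open>exp_supermartingale_step\<close>.

  Under (II) this gives \<open>2 exp (- r\<^sup>2 / 3)\<close> for the norm, and \<open>2 \<le> d + 1\<close>. Condition (I) implies (II):
  the quantity \<open>\<parallel>\<phi>\<^sub>i\<parallel>\<^sup>2 / \<sigma>\<^sub>i\<^sup>2\<close> is at most a convex combination of the numbers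
  \<open>\<phi>\<^sub>i\<^sub>j\<^sup>2 / \<sigma>\<^sub>i\<^sub>j\<^sup>2\<close>, and \<open>exp\<close> is convex. Condition (II) implies (III) by the Cauchy-Schwarz inequality, so the
  bound for linear forms holds in all three cases. Under (III) the norm is at most twice the largest
  of the linear forms given by a \<open>1/2\<close>-net of the unit sphere; such a net with at most \<open>5\<^sup>d\<close> points exists
  by comparing volumes, and a union bound with \<open>r / 2\<close> in place of \<open>r\<close> finishes the proof.
\<close>

section \<open>Exponential inequalities\<close>

text \<open>
  The constant \<open>9 / 16\<close> is close to the best possible one, which is about \<open>0.557\<close>, so the Taylor
  polynomials of the two sides have to be compared up to order six. On \<open>[0, 2]\<close> their difference is \<open>z\<^sup>2\<close>
  times a sum of squares; beyond, already \<open>z \<le> 9 z\<^sup>2 / 16\<close>.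
\<close>

lemma exp_minus_self_le_exp_sq:
  fixes z :: real
  assumes "0 \<le> z"
  shows "exp z - z \<le> exp (9 / 16 * z\<^sup>2)"
proof (cases "z \<le> 2")
  case True
  obtain t where t: "\<bar>t\<bar> \<le> \<bar>z\<bar>"
    and expz: "exp z = (\<Sum>m<6. z ^ m / fact m) + exp t / fact 6 * z ^ 6"
    using Maclaurin_exp_le by blast
  have "exp t \<le> exp (2::real)" using t True assms by auto
  also have "\<dots> = (exp 1)\<^sup>2" by (simp add: power2_eq_square flip: exp_add)
  also have "\<dots> \<le> 3\<^sup>2" using exp_le by (intro power_mono) auto
  finally have "exp t / 720 * z ^ 6 \<le> 9 / 720 * z ^ 6"
    using assms by (intro mult_right_mono) auto
  then have upper: "exp z \<le> 1 + z + z\<^sup>2 / 2 + z ^ 3 / 6 + z ^ 4 / 24 + z ^ 5 / 120 + z ^ 6 / 80"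
    unfolding expz by (simp add: eval_nat_numeral fact_numeral)
  define y where "y = 9 / 16 * z\<^sup>2"
  obtain u where "exp y = (\<Sum>m<4. y ^ m / fact m) + exp u / fact 4 * y ^ 4"
    using Maclaurin_exp_le by blast
  moreover have "0 \<le> exp u / fact 4 * y ^ 4" by simp
  ultimately have "(\<Sum>m<4. y ^ m / fact m) \<le> exp y" by linarith
  then have "1 + y + y\<^sup>2 / 2 + y ^ 3 / 6 \<le> exp y"
    by (simp add: eval_nat_numeral fact_numeral)
  moreover have "y\<^sup>2 = 81 / 256 * z ^ 4" "y ^ 3 = 729 / 4096 * z ^ 6"
    unfolding y_def by (simp_all add: eval_nat_numeral)
  ultimately have lower: "1 + 9 / 16 * z\<^sup>2 + 81 / 512 * z ^ 4 + 729 / 24576 * z ^ 6 \<le> exp y"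
    unfolding y_def by simp
  \<comment> \<open>The two squares absorb the odd terms \<open>- z / 6\<close> and \<open>- z\<^sup>3 / 120\<close>; what is left of the
    coefficients of \<open>z\<^sup>2\<close> and \<open>z\<^sup>4\<close> is positive.\<close>
  have "0 \<le> (1/4 - z/3)\<^sup>2 + z\<^sup>2 * (1/15 - z/16)\<^sup>2
      + (81/512 - 1/24 - 1/9 - 1/225) * z\<^sup>2 + (729/24576 - 1/80 - 1/256) * z^4"
    by (intro add_nonneg_nonneg mult_nonneg_nonneg) auto
  also have "\<dots> = 1/16 - z/6 + (81/512 - 1/24) * z\<^sup>2 - z^3/120 + (729/24576 - 1/80) * z^4"
    by (simp add: power2_eq_square eval_nat_numeral algebra_simps)
  finally have "0 \<le> z\<^sup>2 * \<dots>" by simp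
  then have "z + z\<^sup>2 / 2 + z ^ 3 / 6 + z ^ 4 / 24 + z ^ 5 / 120 + z ^ 6 / 80 - z
     \<le> 9 / 16 * z\<^sup>2 + 81 / 512 * z ^ 4 + 729 / 24576 * z ^ 6"
    by (simp add: eval_nat_numeral algebra_simps)
  then show ?thesis using upper lower unfolding y_def by linarith
next
  case False
  then have "2 * (9/16 * z) \<le> z * (9/16 * z)" by (intro mult_right_mono) auto
  then have "z \<le> 9 / 16 * z\<^sup>2" using False by (simp add: power2_eq_square)
  then have "exp z \<le> exp (9 / 16 * z\<^sup>2)" by simp
  then show ?thesis using assms by linarith
qed


text \<open>
  This is convexity of \<open>exp\<close> between \<open>0\<close> and \<open>x - 1\<close>, multiplied by \<open>exp \<alpha>\<close>. The bound is affine in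
  \<open>exp x\<close> and takes the value \<open>exp \<alpha>\<close> at \<open>exp x = exp 1\<close>: it therefore turns a conditional mean of at most
  \<open>exp 1\<close> for \<open>exp x\<close> into one of at most \<open>exp \<alpha>\<close> for \<open>exp (\<alpha> x)\<close>, without an appeal to Jensen's
  inequality for conditional expectations.
\<close>

lemma exp_scaled_le_affine:
  fixes \<alpha> x :: real
  assumes "0 \<le> \<alpha>" "\<alpha> \<le> 1"
  shows "exp (\<alpha> * x) \<le> (1 - \<alpha>) * exp \<alpha> + \<alpha> * exp (\<alpha> - 1) * exp x"
proof -
  have "convex_on UNIV (exp :: real \<Rightarrow> real)" by (rule exp_convex)
  from convex_onD[OF this assms, of 0 "x - 1"]
  have "exp (\<alpha> * (x - 1)) \<le> (1 - \<alpha>) + \<alpha> * exp (x - 1)" by simp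
  then have "exp \<alpha> * exp (\<alpha> * (x - 1)) \<le> exp \<alpha> * ((1 - \<alpha>) + \<alpha> * exp (x - 1))" by simp
  moreover have "exp \<alpha> * exp (\<alpha> * (x - 1)) = exp (\<alpha> * x)"
    by (simp add: algebra_simps flip: exp_add)
  moreover have "exp \<alpha> * ((1 - \<alpha>) + \<alpha> * exp (x - 1))
      = (1 - \<alpha>) * exp \<alpha> + \<alpha> * exp (\<alpha> - 1) * exp x"
    by (simp add: algebra_simps exp_diff)
  ultimately show ?thesis by simp
qed

text \<open>
  If \<open>z\<close> is random and \<open>exp (z\<^sup>2 / s\<^sup>2)\<close> has mean at most \<open>exp 1\<close>, then the mean of
  \<open>exp (\<theta> z) - \<theta> z\<close> is at most \<open>exp (3 \<theta>\<^sup>2 s\<^sup>2 / 4)\<close>. There are two regimes, which meet exactly at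
  \<open>\<theta> s = 4 / 3\<close>. Below, \<open>exp_minus_self_le_exp_sq\<close> applies and the exponent \<open>9 (\<theta> s)\<^sup>2 / 16\<close> does not exceed
  \<open>1\<close>. Above, the inequality \<open>\<theta> z \<le> 3 (\<theta> s)\<^sup>2 / 8 + 2 z\<^sup>2 / (3 s\<^sup>2)\<close> suffices, because then
  \<open>2 / 3 \<le> 3 (\<theta> s)\<^sup>2 / 8\<close>.
\<close>

lemma exp_minus_self_le_affine_exp_sq:
  fixes \<theta> s :: real
  assumes "0 \<le> \<theta>" "0 < s"
  obtains A B where "0 \<le> A" "0 \<le> B" "A + B * exp 1 \<le> exp (3 / 4 * \<theta>\<^sup>2 * s\<^sup>2)"
    "\<And>z. 0 \<le> z \<Longrightarrow> exp (\<theta> * z) - \<theta> * z \<le> A + B * exp (z\<^sup>2 / s\<^sup>2)"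
proof (cases "\<theta> * s \<le> 4 / 3")
  case True
  define \<alpha> where "\<alpha> = 9 / 16 * (\<theta> * s)\<^sup>2"
  have "(\<theta> * s)\<^sup>2 \<le> (4 / 3)\<^sup>2" using True assms by (intro power_mono) auto
  then have \<alpha>: "0 \<le> \<alpha>" "\<alpha> \<le> 1" by (simp_all add: \<alpha>_def power2_eq_square)
  show thesis
  proof (rule that)
    show "(1 - \<alpha>) * exp \<alpha> + \<alpha> * exp (\<alpha> - 1) * exp 1 \<le> exp (3 / 4 * \<theta>\<^sup>2 * s\<^sup>2)"
    proof -
      have "(1 - \<alpha>) * exp \<alpha> + \<alpha> * exp (\<alpha> - 1) * exp 1 = exp \<alpha>"
        by (simp add: algebra_simps exp_diff)
      moreover have "\<alpha> \<le> 3 / 4 * \<theta>\<^sup>2 * s\<^sup>2" by (simp add: \<alpha>_def power_mult_distrib)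
      ultimately show ?thesis by simp
    qed
    fix z :: real assume "0 \<le> z"
    then have "exp (\<theta> * z) - \<theta> * z \<le> exp (9 / 16 * (\<theta> * z)\<^sup>2)"
      using assms by (intro exp_minus_self_le_exp_sq) auto
    also have "9 / 16 * (\<theta> * z)\<^sup>2 = \<alpha> * (z\<^sup>2 / s\<^sup>2)"
      using assms by (simp add: \<alpha>_def power_mult_distrib)
    also have "exp \<dots> \<le> (1 - \<alpha>) * exp \<alpha> + \<alpha> * exp (\<alpha> - 1) * exp (z\<^sup>2 / s\<^sup>2)"
      using \<alpha> by (rule exp_scaled_le_affine)
    finally show "exp (\<theta> * z) - \<theta> * z \<le> (1 - \<alpha>) * exp \<alpha> + \<alpha> * exp (\<alpha> - 1) * exp (z\<^sup>2 / s\<^sup>2)" .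
  qed (use \<alpha> in auto)
next
  case False
  define C where "C = exp (3 / 8 * (\<theta> * s)\<^sup>2)"
  have "(4 / 3)\<^sup>2 \<le> (\<theta> * s)\<^sup>2" using False by (intro power_mono) auto
  then have sq: "2 / 3 \<le> 3 / 8 * (\<theta> * s)\<^sup>2" by (simp add: power2_eq_square)
  show thesis
  proof (rule that)
    have "C * ((1 / 3) * exp (2 / 3)) + C * (2 / 3 * exp (2 / 3 - 1)) * exp 1
        = C * ((1 / 3) * exp (2 / 3) + 2 / 3 * (exp (2 / 3 - 1) * exp 1))"
      by (simp add: algebra_simps)
    also have "exp (2 / 3 - 1) * exp 1 = exp (2 / 3 :: real)" by (simp flip: exp_add)
    also have "C * ((1 / 3) * exp (2 / 3) + 2 / 3 * exp (2 / 3)) = exp (3 / 8 * (\<theta> * s)\<^sup>2 + 2 / 3)"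
      by (simp add: C_def flip: exp_add)
    also have "\<dots> \<le> exp (3 / 4 * \<theta>\<^sup>2 * s\<^sup>2)" using sq by (simp add: power_mult_distrib)
    finally show "C * ((1 / 3) * exp (2 / 3)) + C * (2 / 3 * exp (2 / 3 - 1)) * exp 1
        \<le> exp (3 / 4 * \<theta>\<^sup>2 * s\<^sup>2)" .
    fix z :: real assume "0 \<le> z"
    have "0 \<le> 3 / 8 * (\<theta> * s - 4 / 3 * (z / s))\<^sup>2" by simp
    also have "\<dots> = 3 / 8 * (\<theta> * s)\<^sup>2 + 2 / 3 * (z\<^sup>2 / s\<^sup>2) - \<theta> * z"
      using assms by (simp add: power2_eq_square field_simps)
    finally have "exp (\<theta> * z) \<le> exp (3 / 8 * (\<theta> * s)\<^sup>2 + 2 / 3 * (z\<^sup>2 / s\<^sup>2))" by simp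
    also have "\<dots> = C * exp (2 / 3 * (z\<^sup>2 / s\<^sup>2))" by (simp add: C_def exp_add)
    also have "\<dots> \<le> C * ((1 - 2 / 3) * exp (2 / 3) + 2 / 3 * exp (2 / 3 - 1) * exp (z\<^sup>2 / s\<^sup>2))"
      by (intro mult_left_mono exp_scaled_le_affine) (auto simp: C_def)
    also have "\<dots> = C * ((1 / 3) * exp (2 / 3)) + C * (2 / 3 * exp (2 / 3 - 1)) * exp (z\<^sup>2 / s\<^sup>2)"
      by (simp add: algebra_simps)
    finally show "exp (\<theta> * z) - \<theta> * z
        \<le> C * ((1 / 3) * exp (2 / 3)) + C * (2 / 3 * exp (2 / 3 - 1)) * exp (z\<^sup>2 / s\<^sup>2)"
      using mult_nonneg_nonneg[OF assms(1) \<open>0 \<le> z\<close>] by linarith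
  qed (auto simp: C_def)
qed

lemma self_le_sinh:
  fixes x :: real
  assumes "0 \<le> x"
  shows "x \<le> sinh x"
proof -
  have "1 \<le> exp x" "exp (- x) \<le> 1" using assms by simp_all
  then have "exp (- x) \<le> exp x" by linarith
  then show ?thesis using real_le_abs_sinh[of x] assms by (simp add: sinh_def exp_minus)
qed

text \<open>
  For negative \<open>y\<close> this says \<open>\<bar>y\<bar> \<le> sinh \<bar>y\<bar>\<close>. It splits a signed increment into a linear term and a
  function of its size, as \<open>cosh_norm_add_le\<close> does for vectors.
\<close>

lemma exp_le_exp_abs:
  fixes y :: real
  shows "exp y \<le> (exp \<bar>y\<bar> - \<bar>y\<bar>) + y"
  using self_le_sinh[of "- y"] by (cases "0 \<le> y") (auto simp: sinh_def field_simps)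

text \<open>
  The power series of \<open>q \<mapsto> cosh (sqrt q)\<close> has nonnegative coefficients, and every power is convex on
  \<open>[0, \<infinity>)\<close>.
\<close>

lemma cosh_sqrt_convex:
  fixes a b p :: real
  assumes "0 \<le> p" "p \<le> 1"
  shows "cosh (sqrt (p * a\<^sup>2 + (1 - p) * b\<^sup>2)) \<le> p * cosh a + (1 - p) * cosh b"
proof (rule sums_le)
  define q where "q = p * a\<^sup>2 + (1 - p) * b\<^sup>2"
  have q: "0 \<le> q" using assms by (simp add: q_def)
  show "(\<lambda>n. if even n then sqrt (p * a\<^sup>2 + (1 - p) * b\<^sup>2) ^ n /\<^sub>R fact n else 0)
      sums cosh (sqrt (p * a\<^sup>2 + (1 - p) * b\<^sup>2))"
    by (rule cosh_converges)
  show "(\<lambda>n. p * (if even n then a ^ n /\<^sub>R fact n else 0) + (1 - p) * (if even n then b ^ n /\<^sub>R fact n else 0))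
      sums (p * cosh a + (1 - p) * cosh b)"
    by (intro sums_add sums_mult cosh_converges)
  fix n :: nat
  show "(if even n then sqrt (p * a\<^sup>2 + (1 - p) * b\<^sup>2) ^ n /\<^sub>R fact n else 0)
      \<le> p * (if even n then a ^ n /\<^sub>R fact n else 0) + (1 - p) * (if even n then b ^ n /\<^sub>R fact n else 0)"
  proof (cases "even n")
    case True
    then obtain m where n: "n = 2 * m" by (elim evenE)
    have "convex_on {0::real..} (\<lambda>x. x ^ m)"
      by (cases "even m") (auto intro: convex_power_odd convex_on_subset[OF convex_power_even])
    then have "((1 - p) * b\<^sup>2 + p * a\<^sup>2) ^ m \<le> (1 - p) * (b\<^sup>2) ^ m + p * (a\<^sup>2) ^ m"
      using convex_onD[of "{0..}" "\<lambda>x. x ^ m" p "b\<^sup>2" "a\<^sup>2"] assms by simp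
    then have "q ^ m \<le> p * a ^ n + (1 - p) * b ^ n"
      by (simp add: q_def n power_mult add.commute)
    moreover have "sqrt q ^ n = q ^ m" using q by (simp add: n power_mult)
    ultimately have "sqrt q ^ n / fact n \<le> (p * a ^ n + (1 - p) * b ^ n) / fact n"
      by (intro divide_right_mono) auto
    then show ?thesis using True by (simp add: q_def field_simps)
  qed simp
qed

text \<open>
  With the lengths \<open>r\<close> of \<open>s\<close> and \<open>a\<close> of \<open>v\<close> fixed, let \<open>c\<close> be the cosine of the angle between them. Then
  \<open>\<parallel>s + v\<parallel>\<^sup>2\<close> is affine in \<open>c\<close>, so that the left-hand side is convex in \<open>c\<close>, while the right-hand side is
  affine. It is enough to look at \<open>c = 1\<close> and \<open>c = -1\<close>, where \<open>v\<close> is parallel to \<open>s\<close>. There the addition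
  theorem for \<open>cosh\<close> reduces the claim to \<open>\<bar>sinh r\<bar> \<le> cosh r\<close> and \<open>a \<le> sinh a\<close>.
  The second summand is the derivative of \<open>cosh \<parallel>\<cdot>\<parallel>\<close> at \<open>s\<close> in the direction \<open>v\<close>; at \<open>s = 0\<close> the convention
  \<open>x / 0 = 0\<close> gives its correct value.
\<close>

lemma cosh_norm_add_le:
  fixes s v :: "'v :: real_inner"
  shows "cosh (norm (s + v)) \<le>
    cosh (norm s) * (exp (norm v) - norm v) + sinh (norm s) / norm s * (s \<bullet> v)"
proof -
  define r a c where "r = norm s" and "a = norm v" and "c = (s \<bullet> v) / (r * a)"
  have sv: "s \<bullet> v = r * a * c" by (auto simp: r_def a_def c_def)
  have "\<bar>s \<bullet> v\<bar> \<le> r * a" unfolding r_def a_def by (rule Cauchy_Schwarz_ineq2)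
  then have c: "\<bar>c\<bar> \<le> 1"
    by (cases "r * a = 0") (auto simp: c_def abs_divide r_def a_def divide_le_eq_1)
  define p where "p = (1 + c) / 2"
  have p: "0 \<le> p" "p \<le> 1" using c by (auto simp: p_def)
  have "(norm (s + v))\<^sup>2 = r\<^sup>2 + 2 * (r * a * c) + a\<^sup>2"
    by (simp add: r_def a_def power2_norm_eq_inner inner_add_left inner_add_right inner_commute flip: sv[unfolded r_def a_def])
  also have "\<dots> = p * (r + a)\<^sup>2 + (1 - p) * (r - a)\<^sup>2"
    by (simp add: p_def power2_eq_square field_simps)
  finally have "norm (s + v) = sqrt (p * (r + a)\<^sup>2 + (1 - p) * (r - a)\<^sup>2)"
    by (metis norm_ge_zero real_sqrt_unique)
  then have "cosh (norm (s + v)) \<le> p * cosh (r + a) + (1 - p) * cosh (r - a)"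
    using cosh_sqrt_convex[OF p] by simp
  also have "\<dots> \<le> p * (cosh r * (exp a - a) + a * sinh r) + (1 - p) * (cosh r * (exp a - a) - a * sinh r)"
  proof -
    have exp_a: "exp a = cosh a + sinh a" by (simp add: cosh_plus_sinh)
    have d: "0 \<le> sinh a - a" using self_le_sinh[of a] by (simp add: a_def)
    have "sinh r * (sinh a - a) \<le> cosh r * (sinh a - a)"
      "- sinh r * (sinh a - a) \<le> cosh r * (sinh a - a)"
      using mult_right_mono[OF sinh_le_cosh_real[of r] d] mult_right_mono[OF sinh_le_cosh_real[of "- r"] d]
      by simp_all
    then have "cosh (r + a) \<le> cosh r * (exp a - a) + a * sinh r"
      "cosh (r - a) \<le> cosh r * (exp a - a) - a * sinh r"
      by (simp_all add: cosh_add cosh_diff exp_a algebra_simps)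
    then show ?thesis using p by (intro add_mono mult_left_mono) auto
  qed
  also have "\<dots> = cosh r * (exp a - a) + sinh r * a * c"
    by (simp add: p_def field_simps)
  also have "sinh r * a * c = sinh r / r * (s \<bullet> v)"
    by (cases "r = 0") (simp_all add: sv)
  finally show ?thesis by (simp add: r_def a_def)
qed

section \<open>Half-nets of the unit sphere\<close>

text \<open>
  The balls of radius \<open>1 / 4\<close> around the points are disjoint and lie in the ball of radius \<open>5 / 4\<close> around the
  origin; compare volumes.
\<close>

lemma card_separated_subset_sphere_le:
  fixes A :: "'v :: euclidean_space set"
  assumes "finite A" and sphere: "\<And>x. x \<in> A \<Longrightarrow> norm x = 1"
    and sep: "\<And>x y. x \<in> A \<Longrightarrow> y \<in> A \<Longrightarrow> x \<noteq> y \<Longrightarrow> 1 / 2 < dist x y"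
  shows "card A \<le> 5 ^ DIM('v)"
proof -
  let ?V = "unit_ball_vol (DIM('v))"
  have disj: "disjoint_family_on (\<lambda>x. ball x (1 / 4)) A"
  unfolding disjoint_family_on_def
  proof (intro ballI impI)
    fix x y assume "x \<in> A" "y \<in> A" "x \<noteq> y"
    then have "1 / 2 < dist x y" by (rule sep)
    then show "ball x (1 / 4) \<inter> ball y (1 / 4) = {}"
      by (intro disjoint_ballI) simp
  qed
  have "real (card A) * (?V * (1 / 4) ^ DIM('v)) = (\<Sum>x\<in>A. measure lborel (ball x (1 / 4)))"
    by (simp add: content_ball)
  also have "\<dots> = measure lborel (\<Union>x\<in>A. ball x (1 / 4))"
    using \<open>finite A\<close> disj by (intro measure_finite_Union[symmetric]) (auto simp: emeasure_ball)
  also have "\<dots> \<le> measure lborel (ball (0::'v) (5 / 4))"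
  proof (rule measure_mono_fmeasurable)
    show "(\<Union>x\<in>A. ball x (1 / 4)) \<subseteq> ball 0 (5 / 4)"
    proof
      fix z assume "z \<in> (\<Union>x\<in>A. ball x (1 / 4))"
      then obtain x where "x \<in> A" "dist x z < 1 / 4" by auto
      then show "z \<in> ball 0 (5 / 4)"
        using norm_triangle_ineq[of x "z - x"] sphere[of x] by (simp add: dist_norm norm_minus_commute)
    qed
  qed (use \<open>finite A\<close> in \<open>auto intro!: sets.finite_UN simp: fmeasurable_def emeasure_ball\<close>)
  also have "\<dots> = ?V * (5 / 4) ^ DIM('v)" by (simp add: content_ball)
  finally have "real (card A) * (1 / 4) ^ DIM('v) \<le> (5 / 4) ^ DIM('v)"
    by (simp add: mult.left_commute[of "real (card A)"])
  then have "real (card A) \<le> 5 ^ DIM('v)" by (simp add: power_divide divide_le_cancel)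
  then show ?thesis by (simp flip: of_nat_le_iff)
qed

text \<open>
  A separated set of maximal cardinality is a net: a point far from all of its members could be added to
  it.
\<close>

lemma obtain_sphere_half_net:
  obtains N :: "'v :: euclidean_space set" where "finite N" "card N \<le> 5 ^ DIM('v)"
    "\<And>x. x \<in> N \<Longrightarrow> norm x = 1" "\<And>u. norm u = 1 \<Longrightarrow> \<exists>x\<in>N. dist u x \<le> 1 / 2"
proof -
  define P where "P A \<longleftrightarrow> finite A \<and> (\<forall>x\<in>A. norm x = 1) \<and>
    (\<forall>x\<in>A. \<forall>y\<in>A. x \<noteq> y \<longrightarrow> 1 / 2 < dist x y)" for A :: "'v set"
  have bound: "card A \<le> 5 ^ DIM('v)" if "P A" for A
    using that card_separated_subset_sphere_le[of A] by (auto simp: P_def)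
  have "P {}" by (simp add: P_def)
  from ex_has_greatest_nat[where P = P and f = card, OF this]
  obtain N where N: "P N" and max: "\<And>A. P A \<Longrightarrow> card A \<le> card N"
    using bound by (metis le_imp_less_Suc)
  show thesis
  proof (rule that[of N])
    fix u :: 'v assume u: "norm u = 1"
    show "\<exists>x\<in>N. dist u x \<le> 1 / 2"
    proof (rule ccontr)
      assume "\<not> ?thesis"
      then have far: "\<forall>x\<in>N. 1 / 2 < dist u x" by auto
      then have "u \<notin> N" by force
      moreover have "P (insert u N)" using N u far by (auto simp: P_def dist_commute)
      ultimately show False using max[of "insert u N"] N by (simp add: P_def)
    qed
  qed (use N bound in \<open>auto simp: P_def\<close>)
qed

lemma half_net_norm_le:
  fixes S :: "'v :: real_inner"
  assumes net: "\<And>u::'v. norm u = 1 \<Longrightarrow> \<exists>x\<in>N. dist u x \<le> 1 / 2" and "S \<noteq> 0"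
  shows "\<exists>x\<in>N. norm S / 2 \<le> x \<bullet> S"
proof -
  define u where "u = S /\<^sub>R norm S"
  have "norm u = 1" using \<open>S \<noteq> 0\<close> by (simp add: u_def)
  then obtain x where x: "x \<in> N" "dist u x \<le> 1 / 2" using net by blast
  have "(u - x) \<bullet> S \<le> norm (u - x) * norm S" by (rule norm_cauchy_schwarz)
  also have "\<dots> \<le> 1 / 2 * norm S" using x by (intro mult_right_mono) (auto simp: dist_norm)
  finally have "u \<bullet> S - x \<bullet> S \<le> norm S / 2" by (simp add: inner_diff_left)
  moreover have "u \<bullet> S = norm S"
    using \<open>S \<noteq> 0\<close> by (simp add: u_def power2_norm_eq_inner[symmetric] power2_eq_square)
  ultimately show ?thesis using x by (intro bexI[of _ x]) auto
qed

section \<open>One step of the exponential supermartingale\<close>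

declare borel_measurable_nth [measurable]

lemma borel_measurable_cosh [measurable]: "cosh \<in> borel_measurable (borel :: real measure)"
  and borel_measurable_sinh [measurable]: "sinh \<in> borel_measurable (borel :: real measure)"
  by (auto intro!: borel_measurable_continuous_onI continuous_intros)

text \<open>
  The conditional bound \<open>E[exp (Z\<^sup>2 / s\<^sup>2) | F] \<le> exp 1\<close>, tested against all nonnegative \<open>F\<close>-measurable
  weights. In this form it is used in the supermartingale estimate, where the weight is the functional of
  the past, and it passes directly to smaller \<open>Z\<close> and to convex combinations.
\<close>

definition cond_exp_sq_le :: "'a measure \<Rightarrow> 'a measure \<Rightarrow> ('a \<Rightarrow> real) \<Rightarrow> real \<Rightarrow> bool" where
  "cond_exp_sq_le M F Z s \<longleftrightarrow>
     (\<forall>W\<in>borel_measurable F. (\<integral>\<^sup>+\<omega>. W \<omega> * ennreal (exp ((Z \<omega>)\<^sup>2 / s\<^sup>2)) \<partial>M)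
        \<le> ennreal (exp 1) * (\<integral>\<^sup>+\<omega>. W \<omega> \<partial>M))"

lemma cond_exp_sq_le_mono:
  assumes "cond_exp_sq_le M F Z' s" and "\<And>\<omega>. \<bar>Z \<omega>\<bar> \<le> \<bar>Z' \<omega>\<bar>"
  shows "cond_exp_sq_le M F Z s"
  unfolding cond_exp_sq_le_def
proof
  fix W :: "'a \<Rightarrow> ennreal" assume W: "W \<in> borel_measurable F"
  have "(\<integral>\<^sup>+\<omega>. W \<omega> * ennreal (exp ((Z \<omega>)\<^sup>2 / s\<^sup>2)) \<partial>M)
      \<le> (\<integral>\<^sup>+\<omega>. W \<omega> * ennreal (exp ((Z' \<omega>)\<^sup>2 / s\<^sup>2)) \<partial>M)"
    using assms(2) by (intro nn_integral_mono mult_left_mono ennreal_leI)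
      (auto intro!: divide_right_mono simp: abs_le_square_iff)
  also have "\<dots> \<le> ennreal (exp 1) * (\<integral>\<^sup>+\<omega>. W \<omega> \<partial>M)"
    using assms(1) W by (auto simp: cond_exp_sq_le_def)
  finally show "(\<integral>\<^sup>+\<omega>. W \<omega> * ennreal (exp ((Z \<omega>)\<^sup>2 / s\<^sup>2)) \<partial>M)
      \<le> ennreal (exp 1) * (\<integral>\<^sup>+\<omega>. W \<omega> \<partial>M)" .
qed

context sigma_finite_subalgebra
begin

lemma cond_exp_sq_leI:
  assumes [measurable]: "Z \<in> borel_measurable M"
    and le: "AE \<omega> in M. nn_cond_exp M F (\<lambda>\<omega>. ennreal (exp ((Z \<omega>)\<^sup>2 / s\<^sup>2))) \<omega> \<le> ennreal (exp 1)"
  shows "cond_exp_sq_le M F Z s"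
  unfolding cond_exp_sq_le_def
proof
  fix W :: "'a \<Rightarrow> ennreal" assume W: "W \<in> borel_measurable F"
  have [measurable]: "W \<in> borel_measurable M" using subalg W by (rule measurable_from_subalg)
  have "(\<integral>\<^sup>+\<omega>. W \<omega> * ennreal (exp ((Z \<omega>)\<^sup>2 / s\<^sup>2)) \<partial>M)
      = (\<integral>\<^sup>+\<omega>. W \<omega> * nn_cond_exp M F (\<lambda>\<omega>. ennreal (exp ((Z \<omega>)\<^sup>2 / s\<^sup>2))) \<omega> \<partial>M)"
    using W by (intro nn_cond_exp_intg[symmetric]) auto
  also have "\<dots> \<le> (\<integral>\<^sup>+\<omega>. ennreal (exp 1) * W \<omega> \<partial>M)"
  proof (rule nn_integral_mono_AE)
    show "AE \<omega> in M. W \<omega> * nn_cond_exp M F (\<lambda>\<omega>. ennreal (exp ((Z \<omega>)\<^sup>2 / s\<^sup>2))) \<omega> \<le> ennreal (exp 1) * W \<omega>"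
      using le by eventually_elim (subst mult.commute, rule mult_right_mono, auto)
  qed
  also have "\<dots> = ennreal (exp 1) * (\<integral>\<^sup>+\<omega>. W \<omega> \<partial>M)" by (rule nn_integral_cmult) simp
  finally show "(\<integral>\<^sup>+\<omega>. W \<omega> * ennreal (exp ((Z \<omega>)\<^sup>2 / s\<^sup>2)) \<partial>M)
      \<le> ennreal (exp 1) * (\<integral>\<^sup>+\<omega>. W \<omega> \<partial>M)" .
qed

lemma weighted_affine_exp_sq_le:
  fixes W :: "'a \<Rightarrow> real"
  assumes Z: "Z \<in> borel_measurable M" "cond_exp_sq_le M F Z s"
    and W: "W \<in> borel_measurable F" "\<And>\<omega>. 0 \<le> W \<omega>"
    and AB: "0 \<le> A" "0 \<le> B"
  shows "(\<integral>\<^sup>+\<omega>. ennreal (W \<omega> * (A + B * exp ((Z \<omega>)\<^sup>2 / s\<^sup>2))) \<partial>M)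
    \<le> ennreal (A + B * exp 1) * (\<integral>\<^sup>+\<omega>. ennreal (W \<omega>) \<partial>M)"
proof -
  note [measurable] = Z(1) measurable_from_subalg[OF subalg W(1)]
  have "(\<integral>\<^sup>+\<omega>. ennreal (W \<omega> * (A + B * exp ((Z \<omega>)\<^sup>2 / s\<^sup>2))) \<partial>M)
      = (\<integral>\<^sup>+\<omega>. ennreal A * ennreal (W \<omega>)
          + ennreal B * (ennreal (W \<omega>) * ennreal (exp ((Z \<omega>)\<^sup>2 / s\<^sup>2))) \<partial>M)"
    using W(2) AB
    by (intro nn_integral_cong) (simp add: algebra_simps flip: ennreal_mult ennreal_plus)
  also have "\<dots> = ennreal A * (\<integral>\<^sup>+\<omega>. ennreal (W \<omega>) \<partial>M)
      + ennreal B * (\<integral>\<^sup>+\<omega>. ennreal (W \<omega>) * ennreal (exp ((Z \<omega>)\<^sup>2 / s\<^sup>2)) \<partial>M)"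
    by (simp add: nn_integral_add nn_integral_cmult)
  also have "\<dots> \<le> ennreal A * (\<integral>\<^sup>+\<omega>. ennreal (W \<omega>) \<partial>M)
      + ennreal B * (ennreal (exp 1) * (\<integral>\<^sup>+\<omega>. ennreal (W \<omega>) \<partial>M))"
    using Z(2) W(1) by (intro add_left_mono mult_left_mono) (auto simp: cond_exp_sq_le_def)
  also have "\<dots> = ennreal (A + B * exp 1) * (\<integral>\<^sup>+\<omega>. ennreal (W \<omega>) \<partial>M)"
    using AB by (simp add: ennreal_plus ennreal_mult distrib_right mult.assoc)
  finally show ?thesis .
qed

text \<open>
  This is why condition (I) is a special case of condition (II). With \<open>T\<close> the sum of the \<open>(t j)\<^sup>2\<close>, the
  numbers \<open>(t j)\<^sup>2 / T\<close> are weights of a convex combination, with respect to which \<open>\<parallel>Y\<parallel>\<^sup>2 / T\<close> is the mean of the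
  \<open>(Y $ j)\<^sup>2 / (t j)\<^sup>2\<close>; apply the convexity of \<open>exp\<close>.
\<close>

lemma cond_exp_sq_le_norm:
  fixes Y :: "'a \<Rightarrow> real^'d::finite" and t :: "'d \<Rightarrow> real"
  assumes [measurable]: "Y \<in> borel_measurable M"
    and t: "\<And>j. 0 < t j" "(\<Sum>j\<in>UNIV. (t j)\<^sup>2) \<le> s\<^sup>2"
    and bd: "\<And>j. cond_exp_sq_le M F (\<lambda>\<omega>. Y \<omega> $ j) (t j)"
  shows "cond_exp_sq_le M F (\<lambda>\<omega>. norm (Y \<omega>)) s"
  unfolding cond_exp_sq_le_def
proof
  fix W :: "'a \<Rightarrow> ennreal" assume W: "W \<in> borel_measurable F"
  note [measurable] = measurable_from_subalg[OF subalg W]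
  have nz: "t j \<noteq> 0" for j using t(1)[of j] by simp
  define T where "T = (\<Sum>j\<in>UNIV. (t j)\<^sup>2)"
  have T: "0 < T" unfolding T_def using nz by (intro sum_pos) auto
  have weights: "(\<Sum>j\<in>UNIV. (t j)\<^sup>2 / T) = 1"
    using T by (simp add: T_def flip: sum_divide_distrib)
  have conv: "exp ((norm x)\<^sup>2 / s\<^sup>2) \<le> (\<Sum>j\<in>UNIV. (t j)\<^sup>2 / T * exp ((x $ j)\<^sup>2 / (t j)\<^sup>2))" for x :: "real^'d"
  proof -
    have norm_sq: "(norm x)\<^sup>2 = (\<Sum>j\<in>UNIV. (x $ j)\<^sup>2)"
      unfolding power2_norm_eq_inner by (simp add: inner_vec_def power2_eq_square)
    have "(norm x)\<^sup>2 / s\<^sup>2 \<le> (norm x)\<^sup>2 / T"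
      using T t(2) by (intro frac_le) (auto simp: T_def)
    also have "\<dots> = (\<Sum>j\<in>UNIV. (t j)\<^sup>2 / T * ((x $ j)\<^sup>2 / (t j)\<^sup>2))"
      using nz by (simp add: norm_sq sum_divide_distrib)
    finally have "exp ((norm x)\<^sup>2 / s\<^sup>2) \<le> exp (\<Sum>j\<in>UNIV. (t j)\<^sup>2 / T * ((x $ j)\<^sup>2 / (t j)\<^sup>2))" by simp
    also have "\<dots> \<le> (\<Sum>j\<in>UNIV. (t j)\<^sup>2 / T * exp ((x $ j)\<^sup>2 / (t j)\<^sup>2))"
      using convex_on_sum[OF _ _ exp_convex weights, where y = "\<lambda>j. (x $ j)\<^sup>2 / (t j)\<^sup>2"] T by simp
    finally show ?thesis .
  qed
  have "(\<integral>\<^sup>+\<omega>. W \<omega> * ennreal (exp ((norm (Y \<omega>))\<^sup>2 / s\<^sup>2)) \<partial>M)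
      \<le> (\<integral>\<^sup>+\<omega>. (\<Sum>j\<in>UNIV. ennreal ((t j)\<^sup>2 / T) * (W \<omega> * ennreal (exp ((Y \<omega> $ j)\<^sup>2 / (t j)\<^sup>2)))) \<partial>M)"
  proof (rule nn_integral_mono)
    fix \<omega>
    have "W \<omega> * ennreal (exp ((norm (Y \<omega>))\<^sup>2 / s\<^sup>2))
        \<le> W \<omega> * ennreal (\<Sum>j\<in>UNIV. (t j)\<^sup>2 / T * exp ((Y \<omega> $ j)\<^sup>2 / (t j)\<^sup>2))"
      by (intro mult_left_mono ennreal_leI conv) simp
    also have "\<dots> = (\<Sum>j\<in>UNIV. ennreal ((t j)\<^sup>2 / T) * (W \<omega> * ennreal (exp ((Y \<omega> $ j)\<^sup>2 / (t j)\<^sup>2))))"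
    proof -
      have "ennreal (\<Sum>j\<in>UNIV. (t j)\<^sup>2 / T * exp ((Y \<omega> $ j)\<^sup>2 / (t j)\<^sup>2))
          = (\<Sum>j\<in>UNIV. ennreal ((t j)\<^sup>2 / T) * ennreal (exp ((Y \<omega> $ j)\<^sup>2 / (t j)\<^sup>2)))"
        using T by (simp flip: ennreal_mult)
      then show ?thesis by (simp only: sum_distrib_left mult.left_commute[of "W \<omega>"])
    qed
    finally show "W \<omega> * ennreal (exp ((norm (Y \<omega>))\<^sup>2 / s\<^sup>2))
        \<le> (\<Sum>j\<in>UNIV. ennreal ((t j)\<^sup>2 / T) * (W \<omega> * ennreal (exp ((Y \<omega> $ j)\<^sup>2 / (t j)\<^sup>2))))" .
  qed
  also have "\<dots> = (\<Sum>j\<in>UNIV. ennreal ((t j)\<^sup>2 / T) * (\<integral>\<^sup>+\<omega>. W \<omega> * ennreal (exp ((Y \<omega> $ j)\<^sup>2 / (t j)\<^sup>2)) \<partial>M))"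
    by (simp add: nn_integral_sum nn_integral_cmult)
  also have "\<dots> \<le> (\<Sum>j\<in>UNIV. ennreal ((t j)\<^sup>2 / T) * (ennreal (exp 1) * (\<integral>\<^sup>+\<omega>. W \<omega> \<partial>M)))"
    using bd W by (intro sum_mono mult_left_mono) (auto simp: cond_exp_sq_le_def)
  also have "\<dots> = ennreal (exp 1) * (\<integral>\<^sup>+\<omega>. W \<omega> \<partial>M)"
  proof -
    have "(\<Sum>j\<in>UNIV. ennreal ((t j)\<^sup>2 / T)) = 1" using T weights by (subst sum_ennreal) auto
    then show ?thesis by (simp flip: sum_distrib_right)
  qed
  finally show "(\<integral>\<^sup>+\<omega>. W \<omega> * ennreal (exp ((norm (Y \<omega>))\<^sup>2 / s\<^sup>2)) \<partial>M)
      \<le> ennreal (exp 1) * (\<integral>\<^sup>+\<omega>. W \<omega> \<partial>M)" .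
qed

lemma integral_mult_centred_eq_0:
  fixes g y :: "'a \<Rightarrow> real"
  assumes "integrable M (\<lambda>\<omega>. g \<omega> * y \<omega>)" "g \<in> borel_measurable F" "y \<in> borel_measurable M"
    and "AE \<omega> in M. real_cond_exp M F y \<omega> = 0"
  shows "(\<integral>\<omega>. g \<omega> * y \<omega> \<partial>M) = 0"
proof -
  have "(\<integral>\<omega>. g \<omega> * y \<omega> \<partial>M) = (\<integral>\<omega>. g \<omega> * real_cond_exp M F y \<omega> \<partial>M)"
    using assms by (intro real_cond_exp_intg(2)[symmetric])
  also have "\<dots> = 0"
    by (rule integral_eq_zero_AE) (use assms(4) in auto)
  finally show ?thesis .
qed

text \<open>
  Here \<open>W\<close> and \<open>H\<close> are the values of an exponential functional before and after an increment of size \<open>Z\<close>.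
  The sum over \<open>J\<close> is the part that is linear in the increment, with components \<open>y j\<close> and coefficients
  \<open>g j\<close> determined by the past. It has integral zero once it is known to be integrable, which follows
  from the exponential moments of \<open>Z\<close>. Keeping the linear part abstract covers a scalar increment
  (\<open>J\<close> a singleton) as well as a vector given by its coordinates.
\<close>

lemma exp_supermartingale_step:
  fixes W H Z :: "'a \<Rightarrow> real" and g y :: "'j \<Rightarrow> 'a \<Rightarrow> real"
  assumes Z: "Z \<in> borel_measurable M" "\<And>\<omega>. 0 \<le> Z \<omega>" "cond_exp_sq_le M F Z s"
    and \<theta>: "0 \<le> \<theta>" and s: "0 < s"
    and W: "W \<in> borel_measurable F" "\<And>\<omega>. 0 \<le> W \<omega>" "(\<integral>\<^sup>+\<omega>. ennreal (W \<omega>) \<partial>M) < \<infinity>"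
    and H: "\<And>\<omega>. 0 \<le> H \<omega>"
      "\<And>\<omega>. H \<omega> \<le> W \<omega> * (exp (\<theta> * Z \<omega>) - \<theta> * Z \<omega>) + (\<Sum>j\<in>J. g j \<omega> * y j \<omega>)"
    and g: "\<And>j. j \<in> J \<Longrightarrow> g j \<in> borel_measurable F"
    and y: "\<And>j. j \<in> J \<Longrightarrow> y j \<in> borel_measurable M"
      "\<And>j. j \<in> J \<Longrightarrow> AE \<omega> in M. real_cond_exp M F (y j) \<omega> = 0"
    and gy: "\<And>j \<omega>. j \<in> J \<Longrightarrow> \<bar>g j \<omega> * y j \<omega>\<bar> \<le> C * (W \<omega> * Z \<omega>)"
  shows "(\<integral>\<^sup>+\<omega>. ennreal (H \<omega>) \<partial>M)
    \<le> ennreal (exp (3 / 4 * \<theta>\<^sup>2 * s\<^sup>2)) * (\<integral>\<^sup>+\<omega>. ennreal (W \<omega>) \<partial>M)"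
proof -
  note [measurable] = Z(1) y(1) measurable_from_subalg[OF subalg W(1)]
    measurable_from_subalg[OF subalg g]
  define \<Psi> where "\<Psi> \<omega> = W \<omega> * (exp (\<theta> * Z \<omega>) - \<theta> * Z \<omega>)" for \<omega>
  have [measurable]: "\<Psi> \<in> borel_measurable M" unfolding \<Psi>_def by measurable
  have \<Psi>_nonneg: "0 \<le> \<Psi> \<omega>" for \<omega>
    unfolding \<Psi>_def using exp_ge_add_one_self[of "\<theta> * Z \<omega>"]
    by (intro mult_nonneg_nonneg W(2)) linarith
  obtain A B where AB: "0 \<le> A" "0 \<le> B" "A + B * exp 1 \<le> exp (3 / 4 * \<theta>\<^sup>2 * s\<^sup>2)"
    and le: "\<And>z. 0 \<le> z \<Longrightarrow> exp (\<theta> * z) - \<theta> * z \<le> A + B * exp (z\<^sup>2 / s\<^sup>2)"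
    using exp_minus_self_le_affine_exp_sq[OF \<theta> s] by blast
  have "(\<integral>\<^sup>+\<omega>. ennreal (\<Psi> \<omega>) \<partial>M) \<le> (\<integral>\<^sup>+\<omega>. ennreal (W \<omega> * (A + B * exp ((Z \<omega>)\<^sup>2 / s\<^sup>2))) \<partial>M)"
    unfolding \<Psi>_def by (intro nn_integral_mono ennreal_leI mult_left_mono le Z(2) W(2))
  also have "\<dots> \<le> ennreal (A + B * exp 1) * (\<integral>\<^sup>+\<omega>. ennreal (W \<omega>) \<partial>M)"
    using Z W AB by (intro weighted_affine_exp_sq_le)
  also have "\<dots> \<le> ennreal (exp (3 / 4 * \<theta>\<^sup>2 * s\<^sup>2)) * (\<integral>\<^sup>+\<omega>. ennreal (W \<omega>) \<partial>M)"
    using AB by (intro mult_right_mono ennreal_leI) auto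
  finally have \<Psi>_le: "(\<integral>\<^sup>+\<omega>. ennreal (\<Psi> \<omega>) \<partial>M)
      \<le> ennreal (exp (3 / 4 * \<theta>\<^sup>2 * s\<^sup>2)) * (\<integral>\<^sup>+\<omega>. ennreal (W \<omega>) \<partial>M)" .
  also have "\<dots> < \<infinity>" using W(3) by (simp add: ennreal_mult_less_top)
  finally have \<Psi>_int: "integrable M \<Psi>"
    using \<Psi>_nonneg by (intro integrableI_nonneg) auto
  \<comment> \<open>Integrability of \<open>W Z\<close>, the majorant of every linear term: \<open>x \<le> 1 + x\<^sup>2 \<le> exp (x\<^sup>2)\<close> at \<open>x = Z / s\<close>.\<close>
  have "(\<integral>\<^sup>+\<omega>. ennreal (W \<omega> * Z \<omega>) \<partial>M) \<le> (\<integral>\<^sup>+\<omega>. ennreal (W \<omega> * (0 + s * exp ((Z \<omega>)\<^sup>2 / s\<^sup>2))) \<partial>M)"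
  proof (intro nn_integral_mono ennreal_leI mult_left_mono W(2))
    fix \<omega>
    have "0 \<le> (Z \<omega> / s - 1 / 2)\<^sup>2" by simp
    then have "Z \<omega> / s \<le> 1 + (Z \<omega> / s)\<^sup>2" unfolding power2_diff by (simp add: power_one_over)
    then have "Z \<omega> / s \<le> 1 + (Z \<omega>)\<^sup>2 / s\<^sup>2" by (simp add: power_divide)
    also have "\<dots> \<le> exp ((Z \<omega>)\<^sup>2 / s\<^sup>2)" by (rule exp_ge_add_one_self)
    finally show "Z \<omega> \<le> 0 + s * exp ((Z \<omega>)\<^sup>2 / s\<^sup>2)" using s by (simp add: field_simps)
  qed
  also have "\<dots> \<le> ennreal (0 + s * exp 1) * (\<integral>\<^sup>+\<omega>. ennreal (W \<omega>) \<partial>M)"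
    using Z W s by (intro weighted_affine_exp_sq_le) auto
  also have "\<dots> < \<infinity>" using W(3) by (simp add: ennreal_mult_less_top)
  finally have "integrable M (\<lambda>\<omega>. W \<omega> * Z \<omega>)"
    using Z(2) W(2) by (intro integrableI_nonneg) auto
  then have WZ: "integrable M (\<lambda>\<omega>. C * (W \<omega> * Z \<omega>))" by simp
  have gy_int: "integrable M (\<lambda>\<omega>. g j \<omega> * y j \<omega>)" if "j \<in> J" for j
    by (rule Bochner_Integration.integrable_bound[OF WZ]) (use gy[OF that] g y(1) that in \<open>auto intro: order_trans[OF _ abs_ge_self]\<close>)
  have sum_int: "integrable M (\<lambda>\<omega>. \<Sum>j\<in>J. g j \<omega> * y j \<omega>)"
    using gy_int by (rule Bochner_Integration.integrable_sum)
  have sum_0: "(\<integral>\<omega>. (\<Sum>j\<in>J. g j \<omega> * y j \<omega>) \<partial>M) = 0"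
    using gy_int g y by (simp add: Bochner_Integration.integral_sum integral_mult_centred_eq_0)
  have "(\<integral>\<^sup>+\<omega>. ennreal (H \<omega>) \<partial>M) \<le> (\<integral>\<^sup>+\<omega>. ennreal (\<Psi> \<omega> + (\<Sum>j\<in>J. g j \<omega> * y j \<omega>)) \<partial>M)"
    using H(2) by (intro nn_integral_mono ennreal_leI) (simp add: \<Psi>_def)
  also have "\<dots> = ennreal (\<integral>\<omega>. \<Psi> \<omega> + (\<Sum>j\<in>J. g j \<omega> * y j \<omega>) \<partial>M)"
  proof (rule nn_integral_eq_integral)
    show "AE \<omega> in M. 0 \<le> \<Psi> \<omega> + (\<Sum>j\<in>J. g j \<omega> * y j \<omega>)"
      using H unfolding \<Psi>_def by (intro AE_I2) (rule order_trans)
  qed (use \<Psi>_int sum_int in simp)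
  also have "\<dots> = ennreal (\<integral>\<omega>. \<Psi> \<omega> \<partial>M)" using \<Psi>_int sum_int sum_0 by simp
  also have "\<dots> = (\<integral>\<^sup>+\<omega>. ennreal (\<Psi> \<omega>) \<partial>M)"
    using \<Psi>_int \<Psi>_nonneg by (intro nn_integral_eq_integral[symmetric]) auto
  also note \<Psi>_le
  finally show ?thesis .
qed

end

lemma (in finite_measure) measure_le_of_nn_integral_le:
  fixes H :: "'a \<Rightarrow> real"
  assumes [measurable]: "H \<in> borel_measurable M" and H: "\<And>\<omega>. 0 \<le> H \<omega>"
    and le: "(\<integral>\<^sup>+\<omega>. ennreal (H \<omega>) \<partial>M) \<le> ennreal a"
    and "0 < c" "0 \<le> a" and sub: "\<And>\<omega>. \<omega> \<in> A \<Longrightarrow> \<omega> \<in> space M \<and> c \<le> H \<omega>"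
  shows "measure M A \<le> a / c"
proof -
  have int: "integrable M H"
    by (rule integrableI_nonneg) (use H le in \<open>auto simp: order_le_less_trans\<close>)
  have "measure M A \<le> measure M {\<omega> \<in> space M. c \<le> H \<omega>}"
    by (rule finite_measure_mono) (use sub in auto)
  also have "\<dots> \<le> (\<integral>\<omega>. H \<omega> \<partial>M) / c"
    by (rule integral_Markov_inequality_measure[where A = "{}"]) (use int H \<open>0 < c\<close> in auto)
  also have "\<dots> \<le> a / c"
  proof (rule divide_right_mono)
    have "ennreal (\<integral>\<omega>. H \<omega> \<partial>M) \<le> ennreal a"
      using le nn_integral_eq_integral[OF int] H by simp
    then show "(\<integral>\<omega>. H \<omega> \<partial>M) \<le> a" using \<open>0 \<le> a\<close> by simp
  qed (use \<open>0 < c\<close> in simp)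
  finally show ?thesis .
qed

section \<open>Tail bounds for sums of martingale differences\<close>

text \<open>
  This \<open>\<theta>\<close> minimises \<open>3 \<theta>\<^sup>2 V / 4 - \<theta> r \<surd>V\<close>, with minimal value \<open>- r\<^sup>2 / 3\<close>.
\<close>

lemma optimal_exponents:
  fixes r V :: real
  assumes "0 < V"
  defines "\<theta> \<equiv> 2 * r / (3 * sqrt V)"
  shows "3 / 4 * \<theta>\<^sup>2 * V = r\<^sup>2 / 3" "\<theta> * (r * sqrt V) = 2 * r\<^sup>2 / 3"
  using assms by (simp_all add: power_divide power_mult_distrib power2_eq_square)

locale vector_martingale_differences = prob_space M for M :: "'a measure" +
  fixes F :: "nat \<Rightarrow> 'a measure" and \<phi> :: "nat \<Rightarrow> 'a \<Rightarrow> real^'d::finite"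
  assumes subalgebra_M: "subalgebra M (F i)"
    and subalgebra_mono: "i \<le> k \<Longrightarrow> subalgebra (F k) (F i)"
    and adapted: "1 \<le> i \<Longrightarrow> \<phi> i \<in> borel_measurable (F i)"
    and integrable: "1 \<le> i \<Longrightarrow> integrable M (\<phi> i)"
    and centred: "1 \<le> i \<Longrightarrow> AE \<omega> in M. real_cond_exp M (F (i - 1)) (\<lambda>\<omega>. \<phi> i \<omega> $ j) \<omega> = 0"
begin

definition psum :: "nat \<Rightarrow> 'a \<Rightarrow> real^'d" where
  "psum k \<omega> = (\<Sum>i=1..k. \<phi> i \<omega>)"

lemma psum_0 [simp]: "psum 0 \<omega> = 0" by (simp add: psum_def)

lemma psum_Suc: "psum (Suc k) \<omega> = psum k \<omega> + \<phi> (Suc k) \<omega>" by (simp add: psum_def)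

lemma psum_adapted [measurable]: "psum k \<in> borel_measurable (F k)"
  unfolding psum_def
  by (intro borel_measurable_sum measurable_from_subalg[OF subalgebra_mono adapted]) auto

lemma psum_measurable [measurable]: "psum k \<in> borel_measurable M"
  by (rule measurable_from_subalg[OF subalgebra_M psum_adapted])

lemma \<phi>_measurable: "1 \<le> i \<Longrightarrow> \<phi> i \<in> borel_measurable M"
  using integrable by (rule borel_measurable_integrable)

lemma sigma_finite_subalgebra_F: "sigma_finite_subalgebra M (F i)"
proof -
  interpret finite_measure_subalgebra M "F i"
    using subalgebra_M by unfold_locales
  show ?thesis by unfold_locales
qed

lemma inner_centred:
  assumes "1 \<le> i"
  shows "AE \<omega> in M. real_cond_exp M (F (i - 1)) (\<lambda>\<omega>. e \<bullet> \<phi> i \<omega>) \<omega> = 0"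
proof -
  interpret sigma_finite_subalgebra M "F (i - 1)" by (rule sigma_finite_subalgebra_F)
  have int: "integrable M (\<lambda>\<omega>. \<phi> i \<omega> $ j)" for j
    using integrable_inner_right[OF integrable[OF assms], of "axis j 1"] by (simp add: inner_axis')
  have "AE \<omega> in M. \<forall>j\<in>UNIV. real_cond_exp M (F (i - 1)) (\<lambda>\<omega>. e $ j * \<phi> i \<omega> $ j) \<omega> = 0"
  proof (rule AE_finite_allI)
    fix j
    show "AE \<omega> in M. real_cond_exp M (F (i - 1)) (\<lambda>\<omega>. e $ j * \<phi> i \<omega> $ j) \<omega> = 0"
      using real_cond_exp_cmult[OF int, of "e $ j" j] centred[OF assms, of j]
      by eventually_elim simp
  qed simp
  moreover have "AE \<omega> in M. real_cond_exp M (F (i - 1)) (\<lambda>\<omega>. \<Sum>j\<in>UNIV. e $ j * \<phi> i \<omega> $ j) \<omega>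
      = (\<Sum>j\<in>UNIV. real_cond_exp M (F (i - 1)) (\<lambda>\<omega>. e $ j * \<phi> i \<omega> $ j) \<omega>)"
    using int by (intro real_cond_exp_sum) simp
  ultimately show ?thesis
    unfolding inner_vec_def inner_real_def by eventually_elim simp
qed

text \<open>
  Induction on \<open>k\<close>: each step multiplies \<open>exp (\<theta> (e \<bullet> psum k))\<close> by \<open>exp (\<theta> y)\<close> with \<open>y\<close> the
  increment of \<open>e \<bullet> psum k\<close>, and \<open>exp_le_exp_abs\<close> isolates the centred linear term \<open>\<theta> y\<close>.
\<close>

lemma exp_inner_expectation_le:
  assumes "0 \<le> \<theta>"
    and "\<And>i. i \<in> {1..k} \<Longrightarrow> 0 < \<sigma> i \<and> cond_exp_sq_le M (F (i - 1)) (\<lambda>\<omega>. e \<bullet> \<phi> i \<omega>) (\<sigma> i)"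
  shows "(\<integral>\<^sup>+\<omega>. ennreal (exp (\<theta> * (e \<bullet> psum k \<omega>))) \<partial>M)
    \<le> ennreal (exp (3 / 4 * \<theta>\<^sup>2 * (\<Sum>i=1..k. (\<sigma> i)\<^sup>2)))"
  using assms(2)
proof (induction k)
  case 0
  then show ?case by (simp add: emeasure_space_1)
next
  case (Suc k)
  interpret sigma_finite_subalgebra M "F k" by (rule sigma_finite_subalgebra_F)
  have IH: "(\<integral>\<^sup>+\<omega>. ennreal (exp (\<theta> * (e \<bullet> psum k \<omega>))) \<partial>M)
      \<le> ennreal (exp (3 / 4 * \<theta>\<^sup>2 * (\<Sum>i=1..k. (\<sigma> i)\<^sup>2)))"
    using Suc by simp
  note [measurable] = \<phi>_measurable[of "Suc k", simplified]
  have "(\<integral>\<^sup>+\<omega>. ennreal (exp (\<theta> * (e \<bullet> psum (Suc k) \<omega>))) \<partial>M)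
      \<le> ennreal (exp (3 / 4 * \<theta>\<^sup>2 * (\<sigma> (Suc k))\<^sup>2)) * (\<integral>\<^sup>+\<omega>. ennreal (exp (\<theta> * (e \<bullet> psum k \<omega>))) \<partial>M)"
  proof (rule exp_supermartingale_step[where J = "{()}" and C = \<theta>
        and Z = "\<lambda>\<omega>. \<bar>e \<bullet> \<phi> (Suc k) \<omega>\<bar>"
        and g = "\<lambda>_ \<omega>. \<theta> * exp (\<theta> * (e \<bullet> psum k \<omega>))" and y = "\<lambda>_ \<omega>. e \<bullet> \<phi> (Suc k) \<omega>"])
    show "cond_exp_sq_le M (F k) (\<lambda>\<omega>. \<bar>e \<bullet> \<phi> (Suc k) \<omega>\<bar>) (\<sigma> (Suc k))"
      using Suc.prems[of "Suc k"] by (simp add: cond_exp_sq_le_def)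
    show "(\<integral>\<^sup>+\<omega>. ennreal (exp (\<theta> * (e \<bullet> psum k \<omega>))) \<partial>M) < \<infinity>"
      using IH by (auto simp: order_le_less_trans)
    show "exp (\<theta> * (e \<bullet> psum (Suc k) \<omega>)) \<le> exp (\<theta> * (e \<bullet> psum k \<omega>)) *
        (exp (\<theta> * \<bar>e \<bullet> \<phi> (Suc k) \<omega>\<bar>) - \<theta> * \<bar>e \<bullet> \<phi> (Suc k) \<omega>\<bar>) +
        (\<Sum>j\<in>{()}. \<theta> * exp (\<theta> * (e \<bullet> psum k \<omega>)) * (e \<bullet> \<phi> (Suc k) \<omega>))" for \<omega>
    proof -
      have "exp (\<theta> * (e \<bullet> psum (Suc k) \<omega>))
          = exp (\<theta> * (e \<bullet> psum k \<omega>)) * exp (\<theta> * (e \<bullet> \<phi> (Suc k) \<omega>))"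
        by (simp add: psum_Suc inner_add_right distrib_left exp_add)
      also have "\<dots> \<le> exp (\<theta> * (e \<bullet> psum k \<omega>)) *
          ((exp \<bar>\<theta> * (e \<bullet> \<phi> (Suc k) \<omega>)\<bar> - \<bar>\<theta> * (e \<bullet> \<phi> (Suc k) \<omega>)\<bar>) + \<theta> * (e \<bullet> \<phi> (Suc k) \<omega>))"
        by (intro mult_left_mono exp_le_exp_abs) simp
      finally show ?thesis using assms(1) by (simp add: abs_mult algebra_simps)
    qed
    show "AE \<omega> in M. real_cond_exp M (F k) (\<lambda>\<omega>. e \<bullet> \<phi> (Suc k) \<omega>) \<omega> = 0"
      using inner_centred[of "Suc k" e] by simp
    show "\<bar>\<theta> * exp (\<theta> * (e \<bullet> psum k \<omega>)) * (e \<bullet> \<phi> (Suc k) \<omega>)\<bar>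
        \<le> \<theta> * (exp (\<theta> * (e \<bullet> psum k \<omega>)) * \<bar>e \<bullet> \<phi> (Suc k) \<omega>\<bar>)" for \<omega>
      using assms(1) by (simp add: abs_mult)
  qed (use Suc.prems[of "Suc k"] assms(1) in auto)
  also have "\<dots> \<le> ennreal (exp (3 / 4 * \<theta>\<^sup>2 * (\<sigma> (Suc k))\<^sup>2))
      * ennreal (exp (3 / 4 * \<theta>\<^sup>2 * (\<Sum>i=1..k. (\<sigma> i)\<^sup>2)))"
    by (intro mult_left_mono IH) simp
  also have "\<dots> = ennreal (exp (3 / 4 * \<theta>\<^sup>2 * (\<Sum>i=1..Suc k. (\<sigma> i)\<^sup>2)))"
    by (simp add: algebra_simps flip: ennreal_mult exp_add)
  finally show ?case .
qed

text \<open>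
  The same induction for the norm, with \<open>cosh_norm_add_le\<close> in place of \<open>exp_le_exp_abs\<close>. The hyperbolic
  cosine is used since, unlike \<open>exp \<parallel>\<cdot>\<parallel>\<close>, it is differentiable at the origin; the price is the factor \<open>2\<close> in
  \<open>exp x \<le> 2 cosh x\<close>.
\<close>

lemma cosh_norm_expectation_le:
  assumes "0 \<le> \<theta>"
    and "\<And>i. i \<in> {1..k} \<Longrightarrow> 0 < \<sigma> i \<and> cond_exp_sq_le M (F (i - 1)) (\<lambda>\<omega>. norm (\<phi> i \<omega>)) (\<sigma> i)"
  shows "(\<integral>\<^sup>+\<omega>. ennreal (cosh (\<theta> * norm (psum k \<omega>))) \<partial>M)
    \<le> ennreal (exp (3 / 4 * \<theta>\<^sup>2 * (\<Sum>i=1..k. (\<sigma> i)\<^sup>2)))"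
  using assms(2)
proof (induction k)
  case 0
  then show ?case by (simp add: emeasure_space_1)
next
  case (Suc k)
  interpret sigma_finite_subalgebra M "F k" by (rule sigma_finite_subalgebra_F)
  have IH: "(\<integral>\<^sup>+\<omega>. ennreal (cosh (\<theta> * norm (psum k \<omega>))) \<partial>M)
      \<le> ennreal (exp (3 / 4 * \<theta>\<^sup>2 * (\<Sum>i=1..k. (\<sigma> i)\<^sup>2)))"
    using Suc by simp
  note [measurable] = \<phi>_measurable[of "Suc k", simplified]
  \<comment> \<open>The gradient of \<open>x \<mapsto> cosh (\<theta> \<parallel>x\<parallel>)\<close> at the current partial sum.\<close>
  define g where "g j \<omega> = sinh (\<theta> * norm (psum k \<omega>)) / norm (psum k \<omega>) * (\<theta> * psum k \<omega> $ j)" for j \<omega>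
  have "(\<integral>\<^sup>+\<omega>. ennreal (cosh (\<theta> * norm (psum (Suc k) \<omega>))) \<partial>M)
      \<le> ennreal (exp (3 / 4 * \<theta>\<^sup>2 * (\<sigma> (Suc k))\<^sup>2)) * (\<integral>\<^sup>+\<omega>. ennreal (cosh (\<theta> * norm (psum k \<omega>))) \<partial>M)"
  proof (rule exp_supermartingale_step[where J = UNIV and C = \<theta>
        and Z = "\<lambda>\<omega>. norm (\<phi> (Suc k) \<omega>)" and g = g and y = "\<lambda>j \<omega>. \<phi> (Suc k) \<omega> $ j"])
    show "(\<integral>\<^sup>+\<omega>. ennreal (cosh (\<theta> * norm (psum k \<omega>))) \<partial>M) < \<infinity>"
      using IH by (auto simp: order_le_less_trans)
    show "cosh (\<theta> * norm (psum (Suc k) \<omega>)) \<le> cosh (\<theta> * norm (psum k \<omega>)) *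
        (exp (\<theta> * norm (\<phi> (Suc k) \<omega>)) - \<theta> * norm (\<phi> (Suc k) \<omega>)) +
        (\<Sum>j\<in>UNIV. g j \<omega> * \<phi> (Suc k) \<omega> $ j)" for \<omega>
    proof -
      have "(\<Sum>j\<in>UNIV. g j \<omega> * \<phi> (Suc k) \<omega> $ j)
          = sinh (norm (\<theta> *\<^sub>R psum k \<omega>)) / norm (\<theta> *\<^sub>R psum k \<omega>) * (\<theta> *\<^sub>R psum k \<omega> \<bullet> \<theta> *\<^sub>R \<phi> (Suc k) \<omega>)"
        using assms(1) by (cases "\<theta> = 0") (simp_all add: g_def inner_vec_def sum_distrib_left mult_ac)
      then show ?thesis
        using cosh_norm_add_le[of "\<theta> *\<^sub>R psum k \<omega>" "\<theta> *\<^sub>R \<phi> (Suc k) \<omega>"] assms(1)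
        by (simp add: psum_Suc flip: scaleR_add_right)
    qed
    show "g j \<in> borel_measurable (F k)" for j unfolding g_def by measurable
    show "AE \<omega> in M. real_cond_exp M (F k) (\<lambda>\<omega>. \<phi> (Suc k) \<omega> $ j) \<omega> = 0" for j
      using centred[of "Suc k" j] by simp
    show "\<bar>g j \<omega> * \<phi> (Suc k) \<omega> $ j\<bar> \<le> \<theta> * (cosh (\<theta> * norm (psum k \<omega>)) * norm (\<phi> (Suc k) \<omega>))" for j \<omega>
    proof -
      have "\<bar>sinh (\<theta> * norm (psum k \<omega>)) / norm (psum k \<omega>) * psum k \<omega> $ j\<bar> \<le> sinh (\<theta> * norm (psum k \<omega>))"
      proof (cases "psum k \<omega> = 0")
        case False
        have "sinh (\<theta> * norm (psum k \<omega>)) * \<bar>psum k \<omega> $ j\<bar> \<le> sinh (\<theta> * norm (psum k \<omega>)) * norm (psum k \<omega>)"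
          using assms(1) by (intro mult_left_mono component_le_norm_cart) simp
        then show ?thesis using False assms(1) by (simp add: abs_mult divide_le_eq)
      qed simp
      also have "\<dots> \<le> cosh (\<theta> * norm (psum k \<omega>))" by (rule sinh_le_cosh_real)
      finally have "\<theta> * (\<bar>sinh (\<theta> * norm (psum k \<omega>)) / norm (psum k \<omega>) * psum k \<omega> $ j\<bar> * \<bar>\<phi> (Suc k) \<omega> $ j\<bar>)
          \<le> \<theta> * (cosh (\<theta> * norm (psum k \<omega>)) * norm (\<phi> (Suc k) \<omega>))"
        using assms(1) component_le_norm_cart[of "\<phi> (Suc k) \<omega>" j]
        by (intro mult_left_mono mult_mono) auto
      then show ?thesis using assms(1) by (simp add: g_def abs_mult mult_ac)
    qed
  qed (use Suc.prems[of "Suc k"] assms(1) in auto)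
  also have "\<dots> \<le> ennreal (exp (3 / 4 * \<theta>\<^sup>2 * (\<sigma> (Suc k))\<^sup>2))
      * ennreal (exp (3 / 4 * \<theta>\<^sup>2 * (\<Sum>i=1..k. (\<sigma> i)\<^sup>2)))"
    by (intro mult_left_mono IH) simp
  also have "\<dots> = ennreal (exp (3 / 4 * \<theta>\<^sup>2 * (\<Sum>i=1..Suc k. (\<sigma> i)\<^sup>2)))"
    by (simp add: algebra_simps flip: ennreal_mult exp_add)
  finally show ?case .
qed

lemma inner_tail_le:
  assumes r: "0 \<le> r" and n: "1 \<le> n"
    and bd: "\<And>i. i \<in> {1..n} \<Longrightarrow> 0 < \<sigma> i \<and> cond_exp_sq_le M (F (i - 1)) (\<lambda>\<omega>. e \<bullet> \<phi> i \<omega>) (\<sigma> i)"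
  shows "measure M {\<omega>\<in>space M. r * sqrt (\<Sum>i=1..n. (\<sigma> i)\<^sup>2) \<le> e \<bullet> psum n \<omega>} \<le> exp (- r\<^sup>2 / 3)"
proof -
  define V where "V = (\<Sum>i=1..n. (\<sigma> i)\<^sup>2)"
  have V: "0 < V" unfolding V_def using n bd by (intro sum_pos) force+
  define \<theta> where "\<theta> = 2 * r / (3 * sqrt V)"
  have \<theta>: "0 \<le> \<theta>" using r V by (simp add: \<theta>_def)
  note exponents = optimal_exponents[OF V, of r, folded \<theta>_def]
  have "(\<integral>\<^sup>+\<omega>. ennreal (exp (\<theta> * (e \<bullet> psum n \<omega>))) \<partial>M) \<le> ennreal (exp (r\<^sup>2 / 3))"
    using exp_inner_expectation_le[where k = n, OF \<theta> bd] by (simp only: exponents(1) flip: V_def)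
  then have "measure M {\<omega>\<in>space M. r * sqrt V \<le> e \<bullet> psum n \<omega>} \<le> exp (r\<^sup>2 / 3) / exp (2 * r\<^sup>2 / 3)"
  proof (rule measure_le_of_nn_integral_le[rotated 2])
    fix \<omega> assume "\<omega> \<in> {\<omega>\<in>space M. r * sqrt V \<le> e \<bullet> psum n \<omega>}"
    then show "\<omega> \<in> space M \<and> exp (2 * r\<^sup>2 / 3) \<le> exp (\<theta> * (e \<bullet> psum n \<omega>))"
      using \<theta> by (auto simp: mult_left_mono simp flip: exponents(2))
  qed auto
  also have "\<dots> = exp (- r\<^sup>2 / 3)" by (simp flip: exp_diff)
  finally show ?thesis by (simp add: V_def)
qed

lemma norm_tail_le:
  assumes r: "0 \<le> r" and n: "1 \<le> n"
    and bd: "\<And>i. i \<in> {1..n} \<Longrightarrow> 0 < \<sigma> i \<and> cond_exp_sq_le M (F (i - 1)) (\<lambda>\<omega>. norm (\<phi> i \<omega>)) (\<sigma> i)"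
  shows "measure M {\<omega>\<in>space M. r * sqrt (\<Sum>i=1..n. (\<sigma> i)\<^sup>2) \<le> norm (psum n \<omega>)} \<le> 2 * exp (- r\<^sup>2 / 3)"
proof -
  define V where "V = (\<Sum>i=1..n. (\<sigma> i)\<^sup>2)"
  have V: "0 < V" unfolding V_def using n bd by (intro sum_pos) force+
  define \<theta> where "\<theta> = 2 * r / (3 * sqrt V)"
  have \<theta>: "0 \<le> \<theta>" using r V by (simp add: \<theta>_def)
  note exponents = optimal_exponents[OF V, of r, folded \<theta>_def]
  have "(\<integral>\<^sup>+\<omega>. ennreal (cosh (\<theta> * norm (psum n \<omega>))) \<partial>M) \<le> ennreal (exp (r\<^sup>2 / 3))"
    using cosh_norm_expectation_le[where k = n, OF \<theta> bd] by (simp only: exponents(1) flip: V_def)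
  then have "measure M {\<omega>\<in>space M. r * sqrt V \<le> norm (psum n \<omega>)}
      \<le> exp (r\<^sup>2 / 3) / (exp (2 * r\<^sup>2 / 3) / 2)"
  proof (rule measure_le_of_nn_integral_le[rotated 2])
    fix \<omega> assume \<omega>: "\<omega> \<in> {\<omega>\<in>space M. r * sqrt V \<le> norm (psum n \<omega>)}"
    then have "exp (2 * r\<^sup>2 / 3) / 2 \<le> exp (\<theta> * norm (psum n \<omega>)) / 2"
      using \<theta> by (auto simp: mult_left_mono simp flip: exponents(2))
    also have "\<dots> \<le> cosh (\<theta> * norm (psum n \<omega>))" by (simp add: cosh_def)
    finally show "\<omega> \<in> space M \<and> exp (2 * r\<^sup>2 / 3) / 2 \<le> cosh (\<theta> * norm (psum n \<omega>))" using \<omega> by simp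
  qed auto
  also have "\<dots> = 2 * (exp (r\<^sup>2 / 3) / exp (2 * r\<^sup>2 / 3))" by simp
  also have "\<dots> = 2 * exp (- r\<^sup>2 / 3)" by (simp flip: exp_diff)
  finally show ?thesis by (simp add: V_def)
qed

text \<open>
  By \<open>half_net_norm_le\<close> a large norm forces one of at most \<open>5\<^sup>d\<close> linear forms to be at least half as large;
  halving \<open>r\<close> changes the exponent \<open>- r\<^sup>2 / 3\<close> to \<open>- r\<^sup>2 / 12\<close>. For \<open>r = 0\<close> the sum may vanish and have no
  direction, but then the bound is at least \<open>1\<close>.
\<close>

lemma norm_tail_le_of_inner:
  assumes r: "0 \<le> r" and n: "1 \<le> n"
    and bd: "\<And>i e. i \<in> {1..n} \<Longrightarrow> norm e = 1 \<Longrightarrow>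
      0 < \<sigma> i \<and> cond_exp_sq_le M (F (i - 1)) (\<lambda>\<omega>. e \<bullet> \<phi> i \<omega>) (\<sigma> i)"
  shows "measure M {\<omega>\<in>space M. r * sqrt (\<Sum>i=1..n. (\<sigma> i)\<^sup>2) \<le> norm (psum n \<omega>)}
    \<le> 5 ^ CARD('d) * exp (- r\<^sup>2 / 12)"
proof (cases "r = 0")
  case True
  have "measure M {\<omega>\<in>space M. r * sqrt (\<Sum>i=1..n. (\<sigma> i)\<^sup>2) \<le> norm (psum n \<omega>)} \<le> 1" by simp
  also have "\<dots> \<le> 5 ^ CARD('d) * exp (- r\<^sup>2 / 12)" using True by simp
  finally show ?thesis .
next
  case False
  define V where "V = (\<Sum>i=1..n. (\<sigma> i)\<^sup>2)"
  have V: "0 < V" unfolding V_def using n bd[of _ "axis undefined 1"]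
    by (intro sum_pos) (force simp: norm_axis_1)+
  obtain N :: "(real^'d) set" where N: "finite N" "card N \<le> 5 ^ DIM(real^'d)"
    "\<And>x. x \<in> N \<Longrightarrow> norm x = 1" and net: "\<And>u. norm u = 1 \<Longrightarrow> \<exists>x\<in>N. dist u x \<le> 1 / 2"
    using obtain_sphere_half_net by blast
  define E where "E x = {\<omega>\<in>space M. (r / 2) * sqrt V \<le> x \<bullet> psum n \<omega>}" for x
  have [measurable]: "E x \<in> sets M" for x unfolding E_def by measurable
  have "{\<omega>\<in>space M. r * sqrt V \<le> norm (psum n \<omega>)} \<subseteq> (\<Union>x\<in>N. E x)"
  proof
    fix \<omega> assume \<omega>: "\<omega> \<in> {\<omega>\<in>space M. r * sqrt V \<le> norm (psum n \<omega>)}"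
    moreover have "0 < r * sqrt V" using r False V by simp
    ultimately have "psum n \<omega> \<noteq> 0" by auto
    then obtain x where "x \<in> N" "norm (psum n \<omega>) / 2 \<le> x \<bullet> psum n \<omega>"
      using half_net_norm_le[OF net] by blast
    then show "\<omega> \<in> (\<Union>x\<in>N. E x)" using \<omega> by (auto simp: E_def intro!: bexI[of _ x])
  qed
  then have "measure M {\<omega>\<in>space M. r * sqrt V \<le> norm (psum n \<omega>)} \<le> measure M (\<Union>x\<in>N. E x)"
    using N by (intro finite_measure_mono) auto
  also have "\<dots> \<le> (\<Sum>x\<in>N. measure M (E x))"
    using N by (intro finite_measure_subadditive_finite) auto
  also have "\<dots> \<le> (\<Sum>x\<in>N. exp (- (r / 2)\<^sup>2 / 3))"
    unfolding E_def V_def using r n bd N by (intro sum_mono inner_tail_le) auto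
  also have "\<dots> = real (card N) * exp (- r\<^sup>2 / 12)" by (simp add: power_divide)
  also have "\<dots> \<le> real (5 ^ CARD('d)) * exp (- r\<^sup>2 / 12)"
    using N(2) by (intro mult_right_mono) (simp_all only: of_nat_le_iff exp_ge_zero DIM_cart DIM_real mult_1_right)
  finally show ?thesis by (simp add: V_def)
qed

end

section \<open>The filtration generated by a process\<close>

lemma space_nat_filtration [simp]: "space (nat_filtration M S X i) = space M"
  unfolding nat_filtration_def by (rule space_measure_of) auto

lemma sets_nat_filtration:
  "sets (nat_filtration M S X i) =
    sigma_sets (space M) (\<Union>k\<in>{1..i}. {X k -` A \<inter> space M | A. A \<in> sets S})"
  unfolding nat_filtration_def by (rule sets_measure_of) auto

lemma subalgebra_nat_filtration:
  assumes "\<And>i. 1 \<le> i \<Longrightarrow> X i \<in> M \<rightarrow>\<^sub>M S"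
  shows "subalgebra M (nat_filtration M S X i)"
  unfolding subalgebra_def sets_nat_filtration
  using assms by (auto intro!: sets.sigma_sets_subset measurable_sets)

lemma subalgebra_nat_filtration_mono:
  assumes "i \<le> k"
  shows "subalgebra (nat_filtration M S X k) (nat_filtration M S X i)"
  unfolding subalgebra_def sets_nat_filtration
  using assms by (intro conjI sigma_sets_mono') (auto, force)

lemma measurable_nat_filtration:
  assumes "\<And>i. 1 \<le> i \<Longrightarrow> X i \<in> M \<rightarrow>\<^sub>M S" and k: "k \<in> {1..i}"
  shows "X k \<in> nat_filtration M S X i \<rightarrow>\<^sub>M S"
proof (rule measurableI)
  show "X k \<omega> \<in> space S" if "\<omega> \<in> space (nat_filtration M S X i)" for \<omega>
    using that measurable_space[OF assms(1)] k by auto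
  show "X k -` A \<inter> space (nat_filtration M S X i) \<in> sets (nat_filtration M S X i)"
    if "A \<in> sets S" for A
    unfolding sets_nat_filtration space_nat_filtration using that k by (intro sigma_sets.Basic) blast
qed

section \<open>The concentration inequalities\<close>

theorem theorem10:
  fixes M :: "'a measure" and S :: "'b measure"
    and X :: "nat \<Rightarrow> 'a \<Rightarrow> 'b"
    and f :: "nat \<Rightarrow> (nat \<Rightarrow> 'b) \<Rightarrow> real^'d::finite"
    and \<phi> :: "nat \<Rightarrow> 'a \<Rightarrow> real^'d"
    and \<sigma> :: "nat \<Rightarrow> real" and \<tau> :: "nat \<Rightarrow> 'd \<Rightarrow> real"
    and n :: nat
  defines "F \<equiv> nat_filtration M S X"
  assumes "prob_space M"
    and "n \<ge> 1"
    and "\<And>i. i \<ge> 1 \<Longrightarrow> X i \<in> M \<rightarrow>\<^sub>M S"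
    and "\<And>i. i \<ge> 1 \<Longrightarrow> f i \<in> PiM {1..i} (\<lambda>_. S) \<rightarrow>\<^sub>M borel"
    and "\<And>i \<omega>. i \<ge> 1 \<Longrightarrow> \<omega> \<in> space M \<Longrightarrow> \<phi> i \<omega> = f i (\<lambda>k\<in>{1..i}. X k \<omega>)"
    and "\<And>i. i \<ge> 1 \<Longrightarrow> integrable M (\<phi> i)"
    and "\<And>i j. i \<ge> 1 \<Longrightarrow> AE \<omega> in M. real_cond_exp M (F (i - 1)) (\<lambda>\<omega>. \<phi> i \<omega> $ j) \<omega> = 0"
  shows
    "(cond_I M F n \<phi> \<sigma> \<tau> \<longrightarrow>
       (\<forall>r\<ge>0. measure M {\<omega>\<in>space M. norm (\<Sum>i=1..n. \<phi> i \<omega>) \<ge> r * sqrt (\<Sum>i=1..n. (\<sigma> i)\<^sup>2)}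
          \<le> 2 * exp (- r\<^sup>2 / 4))) \<and>
     (cond_II M F n \<phi> \<sigma> \<longrightarrow>
       (\<forall>r\<ge>0. measure M {\<omega>\<in>space M. norm (\<Sum>i=1..n. \<phi> i \<omega>) \<ge> r * sqrt (\<Sum>i=1..n. (\<sigma> i)\<^sup>2)}
          \<le> (real CARD('d) + 1) * exp (- r\<^sup>2 / 3))) \<and>
     (cond_III M F n \<phi> \<sigma> \<longrightarrow>
       (\<forall>r\<ge>0. measure M {\<omega>\<in>space M. norm (\<Sum>i=1..n. \<phi> i \<omega>) \<ge> r * sqrt (\<Sum>i=1..n. (\<sigma> i)\<^sup>2)}
          \<le> 5 ^ CARD('d) * exp (- r\<^sup>2 / 12))) \<and>
     (cond_I M F n \<phi> \<sigma> \<tau> \<or> cond_II M F n \<phi> \<sigma> \<or> cond_III M F n \<phi> \<sigma> \<longrightarrow>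
       (\<forall>e. norm e = 1 \<longrightarrow>
         (\<forall>r\<ge>0. measure M {\<omega>\<in>space M. e \<bullet> (\<Sum>i=1..n. \<phi> i \<omega>) \<ge> r * sqrt (\<Sum>i=1..n. (\<sigma> i)\<^sup>2)}
            \<le> exp (- r\<^sup>2 / 3))))"
proof -
  note F_def = assms(1) and n = assms(3) and X = assms(4)
  interpret prob_space M by (rule assms(2))
  interpret vector_martingale_differences M F \<phi>
  proof
    fix i k :: nat
    show "subalgebra M (F i)" unfolding F_def using X by (rule subalgebra_nat_filtration)
    show "subalgebra (F k) (F i)" if "i \<le> k"
      unfolding F_def using that by (rule subalgebra_nat_filtration_mono)
    assume i: "1 \<le> i"
    have "(\<lambda>\<omega>. \<lambda>k\<in>{1..i}. X k \<omega>) \<in> F i \<rightarrow>\<^sub>M PiM {1..i} (\<lambda>_. S)"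
      unfolding F_def using X by (intro measurable_restrict measurable_nat_filtration)
    then have "(\<lambda>\<omega>. f i (\<lambda>k\<in>{1..i}. X k \<omega>)) \<in> borel_measurable (F i)"
      using assms(5)[OF i] by (rule measurable_compose)
    then show "\<phi> i \<in> borel_measurable (F i)"
      by (rule measurable_cong[THEN iffD2, rotated]) (use assms(6) i in \<open>simp add: F_def\<close>)
    show "integrable M (\<phi> i)" using i by (rule assms(7))
    show "AE \<omega> in M. real_cond_exp M (F (i - 1)) (\<lambda>\<omega>. \<phi> i \<omega> $ j) \<omega> = 0" for j
      using i by (rule assms(8))
  qed
  note sum_eq = psum_def[symmetric]
  have I_norm: "0 < \<sigma> i \<and> cond_exp_sq_le M (F (i - 1)) (\<lambda>\<omega>. norm (\<phi> i \<omega>)) (\<sigma> i)"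
    if "cond_I M F n \<phi> \<sigma> \<tau>" "i \<in> {1..n}" for i
  proof -
    interpret sigma_finite_subalgebra M "F (i - 1)" by (rule sigma_finite_subalgebra_F)
    have I: "0 < \<sigma> i" "\<And>j. 0 < \<tau> i j" "(\<Sum>j\<in>UNIV. (\<tau> i j)\<^sup>2) \<le> (\<sigma> i)\<^sup>2"
      "\<And>j. AE \<omega> in M. nn_cond_exp M (F (i - 1))
        (\<lambda>\<omega>. ennreal (exp ((\<phi> i \<omega> $ j)\<^sup>2 / (\<tau> i j)\<^sup>2))) \<omega> \<le> ennreal (exp 1)"
      using that by (simp_all add: cond_I_def)
    have [measurable]: "\<phi> i \<in> borel_measurable M" using that(2) by (intro \<phi>_measurable) simp
    have "cond_exp_sq_le M (F (i - 1)) (\<lambda>\<omega>. \<phi> i \<omega> $ j) (\<tau> i j)" for j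
      using I(4) by (intro cond_exp_sq_leI) simp_all
    then show ?thesis
      using I(1-3) by (intro conjI cond_exp_sq_le_norm[where t = "\<tau> i"]) simp_all
  qed
  have II_norm: "0 < \<sigma> i \<and> cond_exp_sq_le M (F (i - 1)) (\<lambda>\<omega>. norm (\<phi> i \<omega>)) (\<sigma> i)"
    if "cond_II M F n \<phi> \<sigma>" "i \<in> {1..n}" for i
  proof -
    interpret sigma_finite_subalgebra M "F (i - 1)" by (rule sigma_finite_subalgebra_F)
    have [measurable]: "\<phi> i \<in> borel_measurable M" using that(2) by (intro \<phi>_measurable) simp
    have "0 < \<sigma> i" "AE \<omega> in M. nn_cond_exp M (F (i - 1))
        (\<lambda>\<omega>. ennreal (exp ((norm (\<phi> i \<omega>))\<^sup>2 / (\<sigma> i)\<^sup>2))) \<omega> \<le> ennreal (exp 1)"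
      using that by (simp_all add: cond_II_def)
    then show ?thesis by (intro conjI cond_exp_sq_leI) simp_all
  qed
  have norm_inner: "cond_exp_sq_le M (F (i - 1)) (\<lambda>\<omega>. e \<bullet> \<phi> i \<omega>) (\<sigma> i)"
    if "norm e = 1" "cond_exp_sq_le M (F (i - 1)) (\<lambda>\<omega>. norm (\<phi> i \<omega>)) (\<sigma> i)" for i e
    using that(2) by (rule cond_exp_sq_le_mono) (use Cauchy_Schwarz_ineq2[of e] that(1) in simp)
  have III_inner: "0 < \<sigma> i \<and> cond_exp_sq_le M (F (i - 1)) (\<lambda>\<omega>. e \<bullet> \<phi> i \<omega>) (\<sigma> i)"
    if "cond_III M F n \<phi> \<sigma>" "i \<in> {1..n}" "norm e = 1" for i e
  proof -
    interpret sigma_finite_subalgebra M "F (i - 1)" by (rule sigma_finite_subalgebra_F)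
    have [measurable]: "\<phi> i \<in> borel_measurable M" using that(2) by (intro \<phi>_measurable) simp
    have "0 < \<sigma> i" "AE \<omega> in M. nn_cond_exp M (F (i - 1))
        (\<lambda>\<omega>. ennreal (exp ((e \<bullet> \<phi> i \<omega>)\<^sup>2 / (\<sigma> i)\<^sup>2))) \<omega> \<le> ennreal (exp 1)"
      using that by (simp_all add: cond_III_def)
    then show ?thesis by (intro conjI cond_exp_sq_leI) simp_all
  qed
  show ?thesis
    unfolding sum_eq
  proof (intro conjI impI allI)
    fix r :: real assume r: "0 \<le> r"
    let ?P = "measure M {\<omega>\<in>space M. r * sqrt (\<Sum>i=1..n. (\<sigma> i)\<^sup>2) \<le> norm (psum n \<omega>)}"
    {
      assume "cond_I M F n \<phi> \<sigma> \<tau>"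
      then have "?P \<le> 2 * exp (- r\<^sup>2 / 3)" using r n I_norm by (intro norm_tail_le) blast+
      also have "\<dots> \<le> 2 * exp (- r\<^sup>2 / 4)" by simp
      finally show "?P \<le> 2 * exp (- r\<^sup>2 / 4)" .
    next
      assume "cond_II M F n \<phi> \<sigma>"
      then have "?P \<le> 2 * exp (- r\<^sup>2 / 3)" using r n II_norm by (intro norm_tail_le) blast+
      also have "\<dots> \<le> (real CARD('d) + 1) * exp (- r\<^sup>2 / 3)"
        using zero_less_card_finite[where 'a = 'd] by (intro mult_right_mono) (linarith, simp)
      finally show "?P \<le> (real CARD('d) + 1) * exp (- r\<^sup>2 / 3)" .
    next
      assume "cond_III M F n \<phi> \<sigma>"
      then show "?P \<le> 5 ^ CARD('d) * exp (- r\<^sup>2 / 12)"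
        using r n III_inner by (intro norm_tail_le_of_inner) blast+
    }
    fix e :: "real^'d" assume e: "norm e = 1"
    assume "cond_I M F n \<phi> \<sigma> \<tau> \<or> cond_II M F n \<phi> \<sigma> \<or> cond_III M F n \<phi> \<sigma>"
    then have "0 < \<sigma> i \<and> cond_exp_sq_le M (F (i - 1)) (\<lambda>\<omega>. e \<bullet> \<phi> i \<omega>) (\<sigma> i)"
      if "i \<in> {1..n}" for i
      using that e I_norm II_norm III_inner norm_inner by blast
    then show "measure M {\<omega>\<in>space M. r * sqrt (\<Sum>i=1..n. (\<sigma> i)\<^sup>2) \<le> e \<bullet> psum n \<omega>} \<le> exp (- r\<^sup>2 / 3)"
      using r n by (intro inner_tail_le) blast+
  qed
qed

end
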